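(* Let $N,n,m,p$ be positive integers, $B\in\mathbb{R}^{n\times p}$, $C\in\mathbb{R}^{m\times n}$, $H\in\mathbb{R}^{n\times m}$, $W=[w_{ij}]\in\mathbb{R}^{N\times N}$ with $w_{ii}=0$ for all $i$, $\Delta=\mathrm{diag}(\delta_1,\dots,\delta_N)$ with $\delta_i\in\{0,1\}$, and $h>0$. Put $\Phi_s=e^hI_{Nn}+(e^h-1)W\otimes HC$ and $\Psi_s=(e^h-1)(\Delta\otimes B)$, and assume $0$ is not an eigenvalue of $\Phi_s$. Then the discrete-time system $X(k+1)=\Phi_sX(k)+\Psi_sU(k)$ is controllable if and only if the continuous-time system $\dot X(t)=(I_{Nn}+W\otimes HC)X(t)+(\Delta\otimes B)U(t)$ is controllable.
   Context: The continuous-time system is controllable in the usual sense (equivalently its PBH rank condition holds for all $s\in\mathbb{C}$). The discrete-time system is called controllable if every initial state can be steered to the origin in finitely many steps. $\otimes$ is the Kronecker product. *)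

theory Defs
  imports "HOL-Analysis.Analysis"
begin

text \<open>Kronecker product of matrices, indexed by product types:
  (A \<otimes> B) ((i,k),(j,l)) = A(i,j) * B(k,l).\<close>
definition kron :: "real^'c^'r \<Rightarrow> real^'d^'s \<Rightarrow> real^('c \<times> 'd)^('r \<times> 's)" where
  "kron A B = (\<chi> r. \<chi> c. A $ fst r $ fst c * B $ snd r $ snd c)"

text \<open>Matrix powers w.r.t. the matrix product.\<close>
primrec mat_pow :: "real^'n^'n \<Rightarrow> nat \<Rightarrow> real^'n^'n" where
  "mat_pow A 0 = mat 1"
| "mat_pow A (Suc k) = A ** mat_pow A k"

text \<open>Diagonal matrix.\<close>
definition diag_mat :: "('n \<Rightarrow> real) \<Rightarrow> real^'n^'n" where
  "diag_mat d = (\<chi> i j. if i = j then d i else 0)"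

text \<open>Controllability of the continuous-time system x' = A x + B u in the usual
  (Kalman) sense: the columns of B, AB, ..., A^(n-1) B span the whole state space.\<close>
definition ct_controllable :: "real^'n^'n \<Rightarrow> real^'u^'n \<Rightarrow> bool" where
  "ct_controllable A B \<longleftrightarrow>
     span (\<Union>k<CARD('n). range (\<lambda>j. column j (mat_pow A k ** B))) = UNIV"

text \<open>State of the discrete-time system x(k+1) = Phi x(k) + Psi u(k).\<close>
primrec dt_state :: "real^'n^'n \<Rightarrow> real^'u^'n \<Rightarrow> real^'n \<Rightarrow> (nat \<Rightarrow> real^'u) \<Rightarrow> nat \<Rightarrow> real^'n" where
  "dt_state Phi Psi x0 U 0 = x0"
| "dt_state Phi Psi x0 U (Suc k) = Phi *v dt_state Phi Psi x0 U k + Psi *v U k"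

text \<open>Discrete-time controllability: every initial state can be steered to the origin
  in finitely many steps.\<close>
definition dt_controllable :: "real^'n^'n \<Rightarrow> real^'u^'n \<Rightarrow> bool" where
  "dt_controllable Phi Psi \<longleftrightarrow> (\<forall>x0. \<exists>K U. dt_state Phi Psi x0 U K = 0)"

end

theory Submission
  imports Defs
begin

text \<open>Both controllability notions reduce to the Krylov subspace
  \<open>K\<^sub>n(A, im B) = span {A\<^sup>i B u | i < n}\<close> being the whole state space: for the
  continuous system this is the Kalman criterion. For the discrete system, the states reachable
  from \<open>0\<close> in \<open>k\<close> steps form \<open>K\<^sub>k(\<Phi>, im \<Psi>)\<close>; this chain becomes stationary by \<open>k = n\<close>
  in a \<open>\<Phi>\<close>-invariant subspace, and since \<open>\<Phi>\<close> is invertible, \<open>\<Phi>\<^sup>k x \<in> K\<^sub>n\<close> forces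
  \<open>x \<in> K\<^sub>n\<close>. Finally, \<open>K\<^sub>k(A, im B)\<close> does not change when \<open>A\<close> is replaced by
  \<open>a I + b A\<close> and \<open>B\<close> by \<open>c B\<close> with \<open>b, c \<noteq> 0\<close>, and
  \<open>\<Phi>\<^sub>s = e\<^sup>h I + (e\<^sup>h - 1) (W \<otimes> HC)\<close> is such an affine image of \<open>I + W \<otimes> HC\<close>.\<close>

definition krylov_space :: "real^'n^'n \<Rightarrow> (real^'n) set \<Rightarrow> nat \<Rightarrow> (real^'n) set" where
  "krylov_space A S k = span (\<Union>i<k. (*v) (mat_pow A i) ` S)"

lemma mat_pow_Suc_mult_vec: "mat_pow A (Suc i) *v x = A *v (mat_pow A i *v x)"
  by (simp add: matrix_vector_mul_assoc)

lemma subspace_krylov_space: "subspace (krylov_space A S k)"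
  by (simp add: krylov_space_def subspace_span)

lemma krylov_space_0 [simp]: "krylov_space A S 0 = {0}"
  by (simp add: krylov_space_def)

lemma krylov_space_mono: "k \<le> l \<Longrightarrow> krylov_space A S k \<subseteq> krylov_space A S l"
  unfolding krylov_space_def by (intro span_mono UN_mono) auto

lemma krylov_space_Suc: "krylov_space A S (Suc k) = span (S \<union> (*v) A ` krylov_space A S k)"
proof -
  have "(\<Union>i<Suc k. (*v) (mat_pow A i) ` S) = S \<union> (*v) A ` (\<Union>i<k. (*v) (mat_pow A i) ` S)"
    unfolding lessThan_Suc_eq_insert_0
    by (auto simp: image_image matrix_vector_mul_assoc image_UN)
  moreover have "(*v) A ` krylov_space A S k = span ((*v) A ` (\<Union>i<k. (*v) (mat_pow A i) ` S))"
    unfolding krylov_space_def by (simp add: span_linear_image matrix_vector_mul_linear)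
  ultimately show ?thesis
    by (simp add: krylov_space_def span_Un span_span)
qed

lemma mult_vec_krylov_space_subset: "(*v) A ` krylov_space A S k \<subseteq> krylov_space A S (Suc k)"
  unfolding krylov_space_Suc by (intro subset_trans[OF _ span_superset]) blast

lemma krylov_space_stable:
  assumes "krylov_space A S (Suc k) = krylov_space A S k"
  shows "krylov_space A S (k + j) = krylov_space A S k"
proof (induction j)
  case (Suc j)
  then show ?case using assms by (simp add: krylov_space_Suc)
qed simp

lemma krylov_space_stabilizes:
  "\<exists>k \<le> CARD('n). krylov_space (A::real^'n^'n) S (Suc k) = krylov_space A S k"
proof (rule ccontr)
  assume "\<not> ?thesis"
  then have grows: "krylov_space A S k \<subset> krylov_space A S (Suc k)" if "k \<le> CARD('n)" for k
    using that krylov_space_mono[of k "Suc k" A S] by auto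
  have "k \<le> dim (krylov_space A S k)" if "k \<le> Suc CARD('n)" for k
    using that
  proof (induction k)
    case (Suc k)
    have "dim (krylov_space A S k) < dim (krylov_space A S (Suc k))"
      using grows[of k] Suc.prems by (intro dim_psubset) (simp add: krylov_space_def span_span)
    then show ?case using Suc by simp
  qed simp
  from this[of "Suc CARD('n)"] dim_subset_UNIV_cart[of "krylov_space A S (Suc CARD('n))"]
  show False by simp
qed

lemma krylov_space_subset_CARD: "krylov_space (A::real^'n^'n) S m \<subseteq> krylov_space A S CARD('n)"
proof -
  obtain k where k: "k \<le> CARD('n)" "krylov_space A S (Suc k) = krylov_space A S k"
    using krylov_space_stabilizes by blast
  have "krylov_space A S m \<subseteq> krylov_space A S (k + m)"
    by (rule krylov_space_mono) simp
  also have "\<dots> = krylov_space A S (k + (CARD('n) - k))"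
    using krylov_space_stable[OF k(2)] by simp
  finally show ?thesis using k(1) by simp
qed

lemma krylov_space_CARD_invariant:
  "(*v) A ` krylov_space (A::real^'n^'n) S CARD('n) \<subseteq> krylov_space A S CARD('n)"
  using mult_vec_krylov_space_subset krylov_space_subset_CARD by blast

lemma krylov_space_span: "krylov_space A (span S) k = krylov_space A S k"
proof -
  have "(*v) (mat_pow A i) ` span S \<subseteq> span (\<Union>i<k. (*v) (mat_pow A i) ` S)" if "i < k" for i
  proof -
    have "(*v) (mat_pow A i) ` span S = span ((*v) (mat_pow A i) ` S)"
      by (simp add: span_linear_image matrix_vector_mul_linear)
    also have "\<dots> \<subseteq> span (\<Union>i<k. (*v) (mat_pow A i) ` S)"
      using that by (intro span_mono) auto
    finally show ?thesis .
  qed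
  moreover have "(\<Union>i<k. (*v) (mat_pow A i) ` S) \<subseteq> span (\<Union>i<k. (*v) (mat_pow A i) ` span S)"
    using span_superset[of S] by (intro subset_trans[OF _ span_superset]) blast
  ultimately show ?thesis
    unfolding krylov_space_def span_eq by blast
qed

lemma affine_mult_vec:
  "(a *\<^sub>R mat 1 + b *\<^sub>R A) *v v = a *\<^sub>R v + b *\<^sub>R (A *v v)" for A :: "real^'n^'n"
  by (simp add: matrix_vector_mult_add_rdistrib flip: scaleR_matrix_vector_assoc)

lemma krylov_space_affine_subset:
  "krylov_space (a *\<^sub>R mat 1 + b *\<^sub>R A) S k \<subseteq> krylov_space A S k"
proof (induction k)
  case (Suc k)
  have "(a *\<^sub>R mat 1 + b *\<^sub>R A) *v v \<in> krylov_space A S (Suc k)" if "v \<in> krylov_space A S k" for v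
  proof -
    have "v \<in> krylov_space A S (Suc k)"
      using that krylov_space_mono[of k "Suc k" A S] by auto
    moreover have "A *v v \<in> krylov_space A S (Suc k)"
      using that mult_vec_krylov_space_subset by blast
    ultimately show ?thesis
      unfolding affine_mult_vec by (intro subspace_add subspace_scale subspace_krylov_space)
  qed
  then have "(*v) (a *\<^sub>R mat 1 + b *\<^sub>R A) ` krylov_space (a *\<^sub>R mat 1 + b *\<^sub>R A) S k
      \<subseteq> krylov_space A S (Suc k)"
    using Suc.IH by blast
  moreover have "S \<subseteq> krylov_space A S (Suc k)"
    by (auto simp: krylov_space_Suc span_base)
  ultimately show ?case
    unfolding krylov_space_Suc[of "a *\<^sub>R mat 1 + b *\<^sub>R A"]
    by (intro span_minimal subspace_krylov_space) blast
qed simp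

lemma krylov_space_affine:
  assumes "b \<noteq> 0"
  shows "krylov_space (a *\<^sub>R mat 1 + b *\<^sub>R A) S k = krylov_space A S k"
proof
  have A_eq: "(- a / b) *\<^sub>R mat 1 + (1 / b) *\<^sub>R (a *\<^sub>R mat 1 + b *\<^sub>R A) = A"
    using assms by (simp add: scaleR_add_right)
  show "krylov_space A S k \<subseteq> krylov_space (a *\<^sub>R mat 1 + b *\<^sub>R A) S k"
    using krylov_space_affine_subset[of "- a / b" "1 / b" "a *\<^sub>R mat 1 + b *\<^sub>R A" S k]
    unfolding A_eq .
qed (rule krylov_space_affine_subset)

lemma range_mult_vec_scaleR:
  assumes "c \<noteq> 0"
  shows "range ((*v) (c *\<^sub>R M)) = range ((*v) (M::real^'a^'b))"
proof -
  have "(*v) (c *\<^sub>R M) = (*v) M \<circ> (*\<^sub>R) c"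
    by (auto simp: scaleR_matrix_vector_assoc[symmetric] matrix_vector_mult_scaleR)
  moreover have "range ((*\<^sub>R) c :: real^'a \<Rightarrow> real^'a) = UNIV"
    using assms by (metis surj_def scaleR_scaleR right_inverse scaleR_one)
  ultimately show ?thesis by (metis image_comp)
qed

lemma column_matrix_matrix_mult: "column j (A ** B) = A *v column j B"
  by (simp add: column_def matrix_matrix_mult_def matrix_vector_mult_def vec_eq_iff)

lemma span_columns: "span (range (\<lambda>j. column j M)) = range ((*v) (M::real^'a^'b))"
proof -
  have "(*v) M ` Basis = range (\<lambda>j. column j M)"
    by (simp add: Basis_vec_def image_UN UNION_singleton_eq_range image_image
        matrix_vector_mult_basis)
  then show ?thesis
    by (metis span_linear_image matrix_vector_mul_linear span_Basis)
qed

lemma ct_controllable_iff_krylov_space: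
  "ct_controllable A B \<longleftrightarrow> krylov_space A (range ((*v) B)) CARD('n) = UNIV"
  for A :: "real^'n^'n"
proof -
  have "(\<Union>k<CARD('n). range (\<lambda>j. column j (mat_pow A k ** B)))
      = (\<Union>k<CARD('n). (*v) (mat_pow A k) ` range (\<lambda>j. column j B))"
    by (simp add: column_matrix_matrix_mult image_image)
  then show ?thesis
    unfolding ct_controllable_def
    by (metis krylov_space_def krylov_space_span span_columns)
qed

lemma dt_state_superposition: "dt_state P Q x U K = mat_pow P K *v x + dt_state P Q 0 U K"
  by (induction K) (simp_all add: matrix_vector_right_distrib matrix_vector_mul_assoc algebra_simps)

lemma dt_state_cong: "(\<And>i. i < K \<Longrightarrow> U i = U' i) \<Longrightarrow> dt_state P Q x U K = dt_state P Q x U' K"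
  by (induction K) auto

lemma range_dt_state_eq_krylov_space:
  "range (\<lambda>U. dt_state P Q 0 U K) = krylov_space P (range ((*v) Q)) K"
proof (induction K)
  case (Suc K)
  let ?T = "range ((*v) Q)" and ?V = "krylov_space P (range ((*v) Q)) K"
  have span_T: "span ?T = ?T"
    by (metis span_linear_image matrix_vector_mul_linear span_UNIV)
  have span_PV: "span ((*v) P ` ?V) = (*v) P ` ?V"
    by (simp add: span_linear_image matrix_vector_mul_linear krylov_space_def span_span)
  have Suc_eq: "krylov_space P ?T (Suc K) = {Q *v u + P *v v | u v. v \<in> ?V}"
    unfolding krylov_space_Suc span_Un span_T span_PV by blast
  show ?case unfolding Suc_eq
  proof (intro equalityI subsetI)
    fix z assume "z \<in> range (\<lambda>U. dt_state P Q 0 U (Suc K))"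
    then obtain U where "z = Q *v U K + P *v dt_state P Q 0 U K" by (auto simp: add.commute)
    then show "z \<in> {Q *v u + P *v v | u v. v \<in> ?V}" using Suc.IH by blast
  next
    fix z assume "z \<in> {Q *v u + P *v v | u v. v \<in> ?V}"
    then obtain u v where z: "z = Q *v u + P *v v" and "v \<in> ?V"
      by blast
    then obtain U where U: "v = dt_state P Q 0 U K"
      using Suc.IH by (metis rangeE)
    have "dt_state P Q 0 (U(K := u)) K = dt_state P Q 0 U K"
      by (rule dt_state_cong) simp
    then have "dt_state P Q 0 (U(K := u)) (Suc K) = z"
      by (simp add: z U add.commute)
    then show "z \<in> range (\<lambda>U. dt_state P Q 0 U (Suc K))" by (metis rangeI)
  qed
qed simp

lemma dt_controllable_iff_mat_pow_in_krylov_space: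
  "dt_controllable P Q \<longleftrightarrow> (\<forall>x. \<exists>K. mat_pow P K *v x \<in> krylov_space P (range ((*v) Q)) K)"
proof -
  have "(\<exists>U. dt_state P Q x U K = 0) \<longleftrightarrow> - (mat_pow P K *v x) \<in> range (\<lambda>U. dt_state P Q 0 U K)"
    for x K
    by (simp add: dt_state_superposition[of P Q x] image_iff neg_eq_iff_add_eq_0)
  moreover have "- y \<in> krylov_space P T K \<longleftrightarrow> y \<in> krylov_space P T K" for y T K
    by (metis minus_minus subspace_neg subspace_krylov_space)
  ultimately show ?thesis
    unfolding dt_controllable_def range_dt_state_eq_krylov_space by simp
qed

lemma invariant_subspace_preimage:
  fixes f :: "'a::euclidean_space \<Rightarrow> 'a"
  assumes "linear f" "inj f" "subspace R" "f ` R \<subseteq> R" "f x \<in> R"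
  shows "x \<in> R"
proof -
  have "dim (f ` R) = dim R"
    using assms(1,2) by (intro dim_image_eq) (auto simp: inj_on_def)
  then have "f ` R = R"
    using assms by (intro subspace_dim_equal) (auto intro: linear_subspace_image)
  then obtain y where "y \<in> R" "f x = f y" using assms(5) by (metis imageE)
  then show ?thesis using assms(2) by (metis injD)
qed

lemma ex_mat_pow_in_krylov_space_iff:
  fixes P :: "real^'n^'n"
  assumes "inj ((*v) P)"
  shows "(\<forall>x. \<exists>K. mat_pow P K *v x \<in> krylov_space P T K) \<longleftrightarrow> krylov_space P T CARD('n) = UNIV"
proof
  assume reach: "\<forall>x. \<exists>K. mat_pow P K *v x \<in> krylov_space P T K"
  let ?R = "krylov_space P T CARD('n)"
  have "mat_pow P K *v x \<in> ?R \<Longrightarrow> x \<in> ?R" for K x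
  proof (induction K)
    case (Suc K)
    then show ?case
      unfolding mat_pow_Suc_mult_vec
      by (blast intro: invariant_subspace_preimage[OF matrix_vector_mul_linear assms
            subspace_krylov_space krylov_space_CARD_invariant])
  qed (simp add: matrix_vector_mul_lid)
  then show "?R = UNIV"
    using reach krylov_space_subset_CARD by blast
qed blast

lemma dt_controllable_iff_krylov_space:
  fixes P :: "real^'n^'n"
  assumes "inj ((*v) P)"
  shows "dt_controllable P Q \<longleftrightarrow> krylov_space P (range ((*v) Q)) CARD('n) = UNIV"
  using dt_controllable_iff_mat_pow_in_krylov_space ex_mat_pow_in_krylov_space_iff[OF assms] by blast

theorem corollary12:
  fixes B :: "real^'p^'n" and C :: "real^'n^'m" and H :: "real^'m^'n"
    and W :: "real^'N^'N" and \<delta> :: "'N \<Rightarrow> real" and h :: real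
  assumes "\<forall>i. W $ i $ i = 0"
    and "\<forall>i. \<delta> i \<in> {0, 1}"
    and "h > 0"
    and "\<not> (\<exists>v. v \<noteq> 0 \<and>
            (exp h *\<^sub>R mat 1 + (exp h - 1) *\<^sub>R kron W (H ** C)) *v v = 0 *\<^sub>R v)"
  shows "dt_controllable (exp h *\<^sub>R mat 1 + (exp h - 1) *\<^sub>R kron W (H ** C))
                         ((exp h - 1) *\<^sub>R kron (diag_mat \<delta>) B)
         \<longleftrightarrow> ct_controllable (mat 1 + kron W (H ** C)) (kron (diag_mat \<delta>) B)"
proof -
  define M where "M = kron W (H ** C)"
  define KB where "KB = kron (diag_mat \<delta>) B"
  define c where "c = exp h - 1"
  have "c \<noteq> 0" using \<open>h > 0\<close> by (simp add: c_def)
  have "inj ((*v) (exp h *\<^sub>R mat 1 + c *\<^sub>R M))"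
    using assms(4) by (auto simp: linear_injective_0[OF matrix_vector_mul_linear] M_def c_def)
  then have "dt_controllable (exp h *\<^sub>R mat 1 + c *\<^sub>R M) (c *\<^sub>R KB)
      \<longleftrightarrow> krylov_space M (range ((*v) KB)) CARD('N \<times> 'n) = UNIV"
    by (simp add: dt_controllable_iff_krylov_space range_mult_vec_scaleR krylov_space_affine
        \<open>c \<noteq> 0\<close>)
  also have "\<dots> \<longleftrightarrow> krylov_space (1 *\<^sub>R mat 1 + 1 *\<^sub>R M) (range ((*v) KB)) CARD('N \<times> 'n) = UNIV"
    by (simp only: krylov_space_affine[OF one_neq_zero])
  also have "\<dots> \<longleftrightarrow> ct_controllable (mat 1 + M) KB"
    by (simp add: ct_controllable_iff_krylov_space)
  finally show ?thesis unfolding M_def KB_def c_def .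
qed

end
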